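(* Let $\alpha_0,\alpha_1,\alpha_2$ be complex parameters with $\alpha_0+2\alpha_1+\alpha_2=1$ and consider the Hamiltonian system $$\frac{dx}{dt}=\frac{\partial H}{\partial y},\quad \frac{dy}{dt}=-\frac{\partial H}{\partial x},\quad \frac{dz}{dt}=\frac{\partial H}{\partial w},\quad \frac{dw}{dt}=-\frac{\partial H}{\partial z}$$ with the polynomial Hamiltonian $H$ given by $$\begin{aligned} &(4t+3)(16t^2-12t+9)H=\\ &-12tx^2y^4+12(x+2\alpha_0 t)xy^3+3\{(\alpha_0+14\alpha_1+9\alpha_2)x-4\alpha_0^2 t\}y^2\\ &+\{-24tx^2-32t^2 x-3\alpha_0(5\alpha_0+14\alpha_1+9\alpha_2)\}y+24x\{x+(4\alpha_0+7\alpha_1+4\alpha_2)t\}\\ &-12tz^2w^4-12\{z-2(\alpha_0+\alpha_2)t\}zw^3+3\{8t^2 z^2-(\alpha_0+6\alpha_1-3\alpha_2)z-4(\alpha_0+\alpha_2)^2 t\}w^2\\ &+\{12tz^2-8(7\alpha_0+8\alpha_1+7\alpha_2)t^2 z+3(5-6\alpha_1-8\alpha_1^2-4\alpha_2)\}w\\ &-3\{(4t^3+1)z+(19\alpha_0+10\alpha_1+7\alpha_2)t\}z\\ &-12x\{-4txwy^3+(4xw+4txw^2-2tzw^2+zw+2t^2 z)y^2\\ &\qquad+(-2xw^2-7tz-4t^2 zw+zw^2+4tzw^3)y+(8tw+5)z\}+24\alpha_0^2 tyw\\ &+12\alpha_1 xw(2w-7y)+6\alpha_2 xyw\{4t(2w-y)-3\}\\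 &+6\alpha_0 y\{4t(2x-z)w^2+(x-12t xy+2z)w+4t^2 z\}+24\alpha_0 \alpha_2 tyw. \end{aligned}$$ This system has the following invariant divisors: $f_0:=x$ when $\alpha_0=0$; $f_1:=yw^2-ty+1$ when $\alpha_1=0$; $f_2:=x+z$ when $\alpha_2=0$.
   Context: A polynomial $f\in\mathbb{C}(t)[x,y,z,w]$ is an invariant divisor of the system (for given parameter values) if its derivative along the flow, $\frac{\partial f}{\partial t}+\frac{\partial H}{\partial y}\frac{\partial f}{\partial x}-\frac{\partial H}{\partial x}\frac{\partial f}{\partial y}+\frac{\partial H}{\partial w}\frac{\partial f}{\partial z}-\frac{\partial H}{\partial z}\frac{\partial f}{\partial w}$, is divisible by $f$ in $\mathbb{C}(t)[x,y,z,w]$; i.e. the hypersurface $f=0$ is invariant under the system. *)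

theory Defs
  imports
    Complex_Main
    "HOL-Computational_Algebra.Polynomial"
    "HOL-Computational_Algebra.Fraction_Field"
begin

text \<open>The field of rational functions \<open>\<complex>(t)\<close>.\<close>

type_synonym ratfun = "complex poly fract"

text \<open>
  The polynomial ring \<open>\<complex>(t)[x,y,z,w]\<close>, represented as \<open>\<complex>(t)[x][y][z][w]\<close>:
  the innermost polynomial variable is \<open>x\<close>, the outermost one is \<open>w\<close>.
\<close>

type_synonym ring4 = "ratfun poly poly poly poly"

definition of_ratfun :: "ratfun \<Rightarrow> ring4" where
  "of_ratfun r = [:[:[:[:r:]:]:]:]"

definition of_complex_const :: "complex \<Rightarrow> ring4" where
  "of_complex_const c = of_ratfun (Fract [:c:] 1)"

definition ratfun_t :: ratfun where
  "ratfun_t = Fract [:0, 1:] 1"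

definition var_t :: ring4 where
  "var_t = of_ratfun ratfun_t"

definition var_x :: ring4 where
  "var_x = [:[:[:[:0, 1:]:]:]:]"

definition var_y :: ring4 where
  "var_y = [:[:[:0, 1:]:]:]"

definition var_z :: ring4 where
  "var_z = [:[:0, 1:]:]"

definition var_w :: ring4 where
  "var_w = [:0, 1:]"

text \<open>The derivative \<open>d/dt\<close> on \<open>\<complex>(t)\<close>, given by the quotient rule on representatives.\<close>

lift_definition ratfun_deriv :: "ratfun \<Rightarrow> ratfun" is
  "\<lambda>q. (pderiv (fst q) * snd q - fst q * pderiv (snd q), snd q * snd q)"
proof -
  fix u v :: "complex poly \<times> complex poly"
  assume uv: "fractrel u v"
  have eq: "fst u * snd v = fst v * snd u"
    using uv by simp
  have "pderiv (fst u * snd v) = pderiv (fst v * snd u)"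
    using eq by simp
  then have eq': "fst u * pderiv (snd v) + snd v * pderiv (fst u)
      = fst v * pderiv (snd u) + snd u * pderiv (fst v)"
    by (simp add: pderiv_mult)
  have "(pderiv (fst u) * snd u - fst u * pderiv (snd u)) * (snd v * snd v)
      = (pderiv (fst v) * snd v - fst v * pderiv (snd v)) * (snd u * snd u)"
    using eq eq' by algebra
  then show "fractrel
      (pderiv (fst u) * snd u - fst u * pderiv (snd u), snd u * snd u)
      (pderiv (fst v) * snd v - fst v * pderiv (snd v), snd v * snd v)"
    using uv by simp
qed

lemma ratfun_deriv_Fract:
  "q \<noteq> 0 \<Longrightarrow> ratfun_deriv (Fract p q) = Fract (pderiv p * q - p * pderiv q) (q * q)"
  by transfer simp

text \<open>
  In the nested representation, each partial derivative acts on the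
  coefficients of all the outer polynomial layers.
\<close>

definition partial_w :: "ring4 \<Rightarrow> ring4" where
  "partial_w = pderiv"

definition partial_z :: "ring4 \<Rightarrow> ring4" where
  "partial_z = map_poly pderiv"

definition partial_y :: "ring4 \<Rightarrow> ring4" where
  "partial_y = map_poly (map_poly pderiv)"

definition partial_x :: "ring4 \<Rightarrow> ring4" where
  "partial_x = map_poly (map_poly (map_poly pderiv))"

definition partial_t :: "ring4 \<Rightarrow> ring4" where
  "partial_t = map_poly (map_poly (map_poly (map_poly ratfun_deriv)))"

text \<open>
  The derivative of \<open>f\<close> along the flow of the non-autonomous Hamiltonian system
  \<open>x' = H\<^sub>y\<close>, \<open>y' = - H\<^sub>x\<close>, \<open>z' = H\<^sub>w\<close>, \<open>w' = - H\<^sub>z\<close>.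
\<close>

definition flow_deriv :: "ring4 \<Rightarrow> ring4 \<Rightarrow> ring4" where
  "flow_deriv H f =
     partial_t f
     + partial_y H * partial_x f - partial_x H * partial_y f
     + partial_w H * partial_z f - partial_z H * partial_w f"

definition invariant_divisor :: "ring4 \<Rightarrow> ring4 \<Rightarrow> bool" where
  "invariant_divisor H f \<longleftrightarrow> f dvd flow_deriv H f"

definition hamiltonian_numerator :: "complex \<Rightarrow> complex \<Rightarrow> complex \<Rightarrow> ring4" where
  "hamiltonian_numerator a0 a1 a2 =
    (let t = var_t; x = var_x; y = var_y; z = var_z; w = var_w;
         \<alpha>0 = of_complex_const a0; \<alpha>1 = of_complex_const a1; \<alpha>2 = of_complex_const a2
     in
      - 12*t*x^2*y^4 + 12*(x + 2*\<alpha>0*t)*x*y^3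
      + 3*((\<alpha>0 + 14*\<alpha>1 + 9*\<alpha>2)*x - 4*\<alpha>0^2*t)*y^2
      + (- 24*t*x^2 - 32*t^2*x - 3*\<alpha>0*(5*\<alpha>0 + 14*\<alpha>1 + 9*\<alpha>2))*y
      + 24*x*(x + (4*\<alpha>0 + 7*\<alpha>1 + 4*\<alpha>2)*t)
      - 12*t*z^2*w^4 - 12*(z - 2*(\<alpha>0 + \<alpha>2)*t)*z*w^3
      + 3*(8*t^2*z^2 - (\<alpha>0 + 6*\<alpha>1 - 3*\<alpha>2)*z - 4*(\<alpha>0 + \<alpha>2)^2*t)*w^2
      + (12*t*z^2 - 8*(7*\<alpha>0 + 8*\<alpha>1 + 7*\<alpha>2)*t^2*z
          + 3*(5 - 6*\<alpha>1 - 8*\<alpha>1^2 - 4*\<alpha>2))*w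
      - 3*((4*t^3 + 1)*z + (19*\<alpha>0 + 10*\<alpha>1 + 7*\<alpha>2)*t)*z
      - 12*x*(- 4*t*x*w*y^3
          + (4*x*w + 4*t*x*w^2 - 2*t*z*w^2 + z*w + 2*t^2*z)*y^2
          + (- 2*x*w^2 - 7*t*z - 4*t^2*z*w + z*w^2 + 4*t*z*w^3)*y
          + (8*t*w + 5)*z)
      + 24*\<alpha>0^2*t*y*w
      + 12*\<alpha>1*x*w*(2*w - 7*y) + 6*\<alpha>2*x*y*w*(4*t*(2*w - y) - 3)
      + 6*\<alpha>0*y*(4*t*(2*x - z)*w^2 + (x - 12*t*x*y + 2*z)*w + 4*t^2*z)
      + 24*\<alpha>0*\<alpha>2*t*y*w)"

definition hamiltonian :: "complex \<Rightarrow> complex \<Rightarrow> complex \<Rightarrow> ring4" where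
  "hamiltonian a0 a1 a2 =
     of_ratfun (inverse ((4 * ratfun_t + 3) * (16 * ratfun_t^2 - 12 * ratfun_t + 9)))
     * hamiltonian_numerator a0 a1 a2"

text \<open>
  The prefactor is a nonzero element of \<open>\<complex>(t)\<close>, so that
  \<open>hamiltonian\<close> does not depend on the convention \<open>inverse 0 = 0\<close>.
\<close>

lemma hamiltonian_prefactor_nonzero:
  "(4 * ratfun_t + 3) * (16 * ratfun_t^2 - 12 * ratfun_t + 9) \<noteq> (0 :: ratfun)"
proof -
  have num: "(numeral n :: ratfun) = Fract [:numeral n:] 1" for n
    by (metis Fract_of_nat_eq of_nat_numeral numeral_poly)
  have "(4 * ratfun_t + 3) * (16 * ratfun_t^2 - 12 * ratfun_t + 9)
      = Fract [:27, 0, 0, 64:] 1"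
    by (simp add: num ratfun_t_def power2_eq_square)
  then show ?thesis
    by (simp add: Zero_fract_def eq_fract)
qed

lemma hamiltonian_equation:
  "(4 * var_t + 3) * (16 * var_t^2 - 12 * var_t + 9) * hamiltonian a0 a1 a2
     = hamiltonian_numerator a0 a1 a2"
proof -
  let ?r = "(4 * ratfun_t + 3) * (16 * ratfun_t^2 - 12 * ratfun_t + 9)"
  have mult: "of_ratfun (r * s) = of_ratfun r * of_ratfun s"
    and add: "of_ratfun (r + s) = of_ratfun r + of_ratfun s"
    and diff: "of_ratfun (r - s) = of_ratfun r - of_ratfun s" for r s
    by (simp_all add: of_ratfun_def)
  have num: "of_ratfun (numeral n) = numeral n" for n
    by (simp add: of_ratfun_def numeral_poly)
  have "(4 * var_t + 3) * (16 * var_t^2 - 12 * var_t + 9) = of_ratfun ?r"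
    by (simp add: mult add diff num var_t_def power2_eq_square)
  then have "(4 * var_t + 3) * (16 * var_t^2 - 12 * var_t + 9) * hamiltonian a0 a1 a2
      = of_ratfun (?r * inverse ?r) * hamiltonian_numerator a0 a1 a2"
    by (simp only: hamiltonian_def mult mult.assoc)
  also have "?r * inverse ?r = 1"
    using hamiltonian_prefactor_nonzero by (rule right_inverse)
  also have "of_ratfun 1 = 1"
    by (simp add: of_ratfun_def one_pCons)
  finally show ?thesis by simp
qed

end

theory Submission
  imports Defs
begin

text \<open>
  Write \<open>H = N / \<Delta>\<close> with \<open>\<Delta> = (4t + 3)(16t\<^sup>2 - 12t + 9)\<close>, a unit that depends on \<open>t\<close> only.
  In each case the restriction of the derivative of \<open>f\<close> along the flow to the hypersurface \<open>f = 0\<close>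
  is read off from a normal form of \<open>N\<close> modulo \<open>f\<close>.
  The part of this derivative that contains \<open>H\<close> is \<open>d H\<close>, where
  \<open>d = f\<^sub>x \<partial>\<^sub>y - f\<^sub>y \<partial>\<^sub>x + f\<^sub>z \<partial>\<^sub>w - f\<^sub>w \<partial>\<^sub>z\<close> is, up to sign, the Hamiltonian vector field of \<open>f\<close>.
  It satisfies \<open>d f = 0\<close>, so it maps the ideal generated by \<open>f\<close> to itself
  (lemma \<open>derivation_dvd_diff\<close>), and \<open>N\<close> may be replaced by any polynomial \<open>B\<close> that is
  congruent to it modulo \<open>f\<close>.

  For \<open>f = x\<close> the field is \<open>\<partial>\<^sub>y\<close>, and if \<open>\<alpha>\<^sub>0 = 0\<close>, then \<open>N\<close> restricted to \<open>x = 0\<close> is free of \<open>y\<close>.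
  For \<open>f = x + z\<close> the field is \<open>\<partial>\<^sub>y + \<partial>\<^sub>w\<close>, whose constants include \<open>p = y - w\<close>, and if
  \<open>\<alpha>\<^sub>2 = 0\<close>, then \<open>N\<close> restricted to \<open>z = -x\<close> contains \<open>y\<close> and \<open>w\<close> only through \<open>p\<close>.

  For \<open>f = y w\<^sup>2 - t y + 1\<close> the field is \<open>d = (t - w\<^sup>2) \<partial>\<^sub>x - 2 y w \<partial>\<^sub>z\<close>, and \<open>f\<close> itself contributes
  the time derivative \<open>-y\<close>; hence \<open>d N\<close> has to be congruent to \<open>\<Delta> y\<close>.
  Modulo \<open>f\<close>, the element \<open>y\<close> is invertible with inverse \<open>t - w\<^sup>2\<close>. Therefore
  \<open>v = z + 2 y\<^sup>2 w x\<close> is a constant of \<open>d\<close> modulo \<open>f\<close>, whereas \<open>y x\<close> has derivative \<open>1\<close>.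
  If \<open>\<alpha>\<^sub>1 = 0\<close>, then \<open>N\<close> is congruent to \<open>\<Delta> y\<^sup>2 x\<close> plus a polynomial in \<open>v\<close> with coefficients
  in \<open>\<complex>[t, y, w]\<close>, and the first summand contributes exactly \<open>\<Delta> y\<close>.
\<close>

section \<open>Derivations of commutative rings\<close>

definition derivation :: "('a::comm_ring_1 \<Rightarrow> 'a) \<Rightarrow> bool" where
  "derivation d \<longleftrightarrow>
     (\<forall>a b. d (a + b) = d a + d b) \<and> (\<forall>a b. d (a * b) = a * d b + d a * b)"

lemma derivation_add: "derivation d \<Longrightarrow> d (a + b) = d a + d b"
  and derivation_mult: "derivation d \<Longrightarrow> d (a * b) = a * d b + d a * b"
  by (simp_all add: derivation_def)

lemma derivation_0: "derivation d \<Longrightarrow> d 0 = 0"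
  using derivation_add[of d 0 0] by simp

lemma derivation_1: "derivation d \<Longrightarrow> d 1 = 0"
  using derivation_mult[of d 1 1] by simp

lemma derivation_minus: "derivation d \<Longrightarrow> d (- a) = - d a"
  using derivation_add[of d a "- a"] by (simp add: derivation_0 add_eq_0_iff)

lemma derivation_diff: "derivation d \<Longrightarrow> d (a - b) = d a - d b"
  using derivation_add[of d a "- b"] by (simp add: derivation_minus)

lemma derivation_numeral: "derivation d \<Longrightarrow> d (numeral n) = 0"
  by (induction n) (simp_all only: numeral.simps derivation_add derivation_1 add_0_right)

lemma derivation_power2: "derivation d \<Longrightarrow> d (a ^ 2) = 2 * a * d a"
  by (simp add: power2_eq_square derivation_mult)

lemma derivation_power_eq_0: "derivation d \<Longrightarrow> d a = 0 \<Longrightarrow> d (a ^ n) = 0"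
  by (induction n) (simp_all add: derivation_1 derivation_mult)

lemmas derivation_rules = derivation_add derivation_diff derivation_minus derivation_mult
  derivation_0 derivation_1 derivation_numeral derivation_power2 derivation_power_eq_0

lemma derivation_sum: "derivation d \<Longrightarrow> d (\<Sum>i\<in>I. g i) = (\<Sum>i\<in>I. d (g i))"
  by (induction I rule: infinite_finite_induct) (simp_all add: derivation_0 derivation_add)

text \<open>
  Since \<open>d f = 0\<close>, the derivation maps a multiple \<open>f k\<close> to the multiple \<open>f (d k)\<close>.
\<close>

lemma derivation_dvd_diff:
  assumes d: "derivation d" and "d f = 0" and "f dvd g - h"
  shows "f dvd d g - d h"
proof -
  from \<open>f dvd g - h\<close> obtain k where "g - h = f * k" ..
  then have "d g - d h = f * d k"
    using derivation_diff[OF d, of g h] by (simp add: derivation_mult[OF d] \<open>d f = 0\<close>)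
  then show ?thesis by simp
qed

text \<open>
  Applied layer by layer, this reduces the Leibniz rule for the partial derivatives, which act on
  the coefficients of nested polynomials, to that for \<^term>\<open>pderiv\<close> and \<^term>\<open>ratfun_deriv\<close>.
\<close>

lemma derivation_map_poly:
  assumes "derivation d"
  shows "derivation (map_poly d)"
proof -
  note [simp] = coeff_map_poly derivation_rules[OF assms] derivation_sum[OF assms]
  have "map_poly d (p * q) = p * map_poly d q + map_poly d p * q" for p q
    by (rule poly_eqI) (simp add: coeff_mult sum.distrib)
  moreover have "map_poly d (p + q) = map_poly d p + map_poly d q" for p q
    by (rule poly_eqI) simp
  ultimately show ?thesis
    by (simp add: derivation_def)
qed

lemma derivation_pderiv: "derivation (pderiv :: 'a::idom poly \<Rightarrow> 'a poly)"
  by (simp add: derivation_def pderiv_add pderiv_mult)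

lemma derivation_ratfun_deriv: "derivation ratfun_deriv"
proof -
  have "ratfun_deriv (a + b) = ratfun_deriv a + ratfun_deriv b
      \<and> ratfun_deriv (a * b) = a * ratfun_deriv b + ratfun_deriv a * b" for a b
  proof -
    obtain p q where a: "a = Fract p q" "q \<noteq> 0" by (cases a) auto
    obtain p' q' where b: "b = Fract p' q'" "q' \<noteq> 0" by (cases b) auto
    show ?thesis using a(2) b(2) unfolding a(1) b(1)
      by (simp add: ratfun_deriv_Fract eq_fract pderiv_mult pderiv_add) (simp add: algebra_simps)
  qed
  then show ?thesis by (simp add: derivation_def)
qed

section \<open>The partial derivatives\<close>

lemma derivation_partial:
  "derivation partial_x" "derivation partial_y" "derivation partial_z"
  "derivation partial_w" "derivation partial_t"
  unfolding partial_x_def partial_y_def partial_z_def partial_w_def partial_t_def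
  by (intro derivation_map_poly derivation_pderiv derivation_ratfun_deriv)+

lemma partial_of_ratfun:
  "partial_x (of_ratfun r) = 0" "partial_y (of_ratfun r) = 0"
  "partial_z (of_ratfun r) = 0" "partial_w (of_ratfun r) = 0"
  "partial_t (of_ratfun r) = of_ratfun (ratfun_deriv r)"
  by (simp_all add: of_ratfun_def partial_x_def partial_y_def partial_z_def partial_w_def
      partial_t_def map_poly_pCons pderiv_pCons derivation_0[OF derivation_ratfun_deriv])

lemma partial_of_complex_const:
  "partial_x (of_complex_const a) = 0" "partial_y (of_complex_const a) = 0"
  "partial_z (of_complex_const a) = 0" "partial_w (of_complex_const a) = 0"
  by (simp_all add: of_complex_const_def partial_of_ratfun)

lemma partial_var:
  "partial_x var_x = 1" "partial_x var_y = 0" "partial_x var_z = 0" "partial_x var_w = 0"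
  "partial_y var_x = 0" "partial_y var_y = 1" "partial_y var_z = 0" "partial_y var_w = 0"
  "partial_z var_x = 0" "partial_z var_y = 0" "partial_z var_z = 1" "partial_z var_w = 0"
  "partial_w var_x = 0" "partial_w var_y = 0" "partial_w var_z = 0" "partial_w var_w = 1"
  "partial_t var_x = 0" "partial_t var_y = 0" "partial_t var_z = 0" "partial_t var_w = 0"
  by (simp_all add: var_x_def var_y_def var_z_def var_w_def partial_x_def partial_y_def
      partial_z_def partial_w_def partial_t_def map_poly_pCons pderiv_pCons one_pCons
      derivation_rules[OF derivation_ratfun_deriv])

lemma partial_var_t:
  "partial_x var_t = 0" "partial_y var_t = 0" "partial_z var_t = 0" "partial_w var_t = 0"
  "partial_t var_t = 1"
proof -
  have "ratfun_deriv ratfun_t = 1"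
    by (simp add: ratfun_t_def ratfun_deriv_Fract pderiv_pCons flip: one_pCons One_fract_def)
  then show "partial_t var_t = 1"
    by (simp add: var_t_def partial_of_ratfun) (simp add: of_ratfun_def one_pCons)
qed (simp_all add: var_t_def partial_of_ratfun)

lemmas partial_simps = partial_var partial_var_t partial_of_complex_const
  derivation_rules[OF derivation_partial(1)] derivation_rules[OF derivation_partial(2)]
  derivation_rules[OF derivation_partial(3)] derivation_rules[OF derivation_partial(4)]
  derivation_rules[OF derivation_partial(5)]

section \<open>Clearing the denominator of the Hamiltonian\<close>

lemma of_complex_const_arith:
  "of_complex_const 0 = 0" "of_complex_const 1 = 1" "of_complex_const (numeral n) = numeral n"
  "of_complex_const (a - b) = of_complex_const a - of_complex_const b"
  "of_complex_const (a * b) = of_complex_const a * of_complex_const b"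
proof -
  show "of_complex_const (numeral n) = numeral n"
    by (simp add: of_complex_const_def of_ratfun_def numeral_poly)
      (metis Fract_of_nat_eq of_nat_numeral numeral_poly)
qed (simp_all add: of_complex_const_def of_ratfun_def Zero_fract_def One_fract_def one_pCons
    mult.commute)

definition hamiltonian_denominator :: ring4 where
  "hamiltonian_denominator = (4 * var_t + 3) * (16 * var_t^2 - 12 * var_t + 9)"

lemma hamiltonian_eq_unit_mult:
  obtains c where "hamiltonian a0 a1 a2 = c * hamiltonian_numerator a0 a1 a2"
    and "c * hamiltonian_denominator = 1"
    and "partial_x c = 0" "partial_y c = 0" "partial_z c = 0" "partial_w c = 0"
proof -
  let ?r = "(4 * ratfun_t + 3) * (16 * ratfun_t^2 - 12 * ratfun_t + 9)"
  have mult: "of_ratfun (r * s) = of_ratfun r * of_ratfun s"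
    and add: "of_ratfun (r + s) = of_ratfun r + of_ratfun s"
    and diff: "of_ratfun (r - s) = of_ratfun r - of_ratfun s"
    and num: "of_ratfun (numeral n) = numeral n" for r s n
    by (simp_all add: of_ratfun_def numeral_poly)
  have "of_ratfun (inverse ?r) * hamiltonian_denominator = of_ratfun (inverse ?r * ?r)"
    by (simp only: hamiltonian_denominator_def mult add diff num var_t_def power2_eq_square)
  also have "inverse ?r * ?r = 1"
    using hamiltonian_prefactor_nonzero by (rule left_inverse)
  also have "of_ratfun 1 = 1"
    by (simp add: of_ratfun_def one_pCons)
  finally show ?thesis
    using that[of "of_ratfun (inverse ?r)"] by (simp only: hamiltonian_def partial_of_ratfun)
qed

text \<open>
  The denominator is a unit that the four spatial derivatives annihilate, so the flow derivative
  may be multiplied by it without changing divisibility.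
\<close>

lemma invariant_divisor_hamiltonianI:
  assumes "N = hamiltonian_numerator a0 a1 a2"
    and dvd: "f dvd hamiltonian_denominator * partial_t f
      + partial_y N * partial_x f - partial_x N * partial_y f
      + partial_w N * partial_z f - partial_z N * partial_w f" (is "_ dvd ?F")
  shows "invariant_divisor (hamiltonian a0 a1 a2) f"
proof -
  obtain c where H: "hamiltonian a0 a1 a2 = c * N" and unit: "c * hamiltonian_denominator = 1"
    and c: "partial_x c = 0" "partial_y c = 0" "partial_z c = 0" "partial_w c = 0"
    unfolding assms(1) by (rule hamiltonian_eq_unit_mult)
  have "flow_deriv (c * N) f = c * ?F + (1 - c * hamiltonian_denominator) * partial_t f"
    by (simp add: flow_deriv_def c derivation_mult[OF derivation_partial(1)]
        derivation_mult[OF derivation_partial(2)] derivation_mult[OF derivation_partial(3)]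
        derivation_mult[OF derivation_partial(4)] algebra_simps)
  then show ?thesis
    using dvd by (simp add: invariant_divisor_def H unit)
qed

section \<open>The three invariant divisors\<close>

text \<open>
  The polynomial \<open>B\<close> below is the restriction of \<open>N\<close> to \<open>x = 0\<close>. It does not contain \<open>y\<close>,
  because every term of \<open>N\<close> with a positive power of \<open>y\<close> is divisible by \<open>x\<close> or by \<open>\<alpha>\<^sub>0\<close>.
\<close>

lemma invariant_divisor_x:
  "invariant_divisor (hamiltonian 0 a1 a2) var_x"
proof -
  define N where "N = hamiltonian_numerator 0 a1 a2"
  define t x y z w \<alpha>1 \<alpha>2
    where "t = var_t" and "x = var_x" and "y = var_y" and "z = var_z" and "w = var_w"
      and "\<alpha>1 = of_complex_const a1" and "\<alpha>2 = of_complex_const a2"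
  note vars = t_def x_def y_def z_def w_def \<alpha>1_def \<alpha>2_def
  define B where "B = - 12*t*z^2*w^4 - 12*(z - 2*\<alpha>2*t)*z*w^3
      + 3*(8*t^2*z^2 - (6*\<alpha>1 - 3*\<alpha>2)*z - 4*\<alpha>2^2*t)*w^2
      + (12*t*z^2 - 8*(8*\<alpha>1 + 7*\<alpha>2)*t^2*z + 3*(5 - 6*\<alpha>1 - 8*\<alpha>1^2 - 4*\<alpha>2))*w
      - 3*((4*t^3 + 1)*z + (10*\<alpha>1 + 7*\<alpha>2)*t)*z"
  have "\<exists>k. N - B = x * k"
    unfolding N_def B_def hamiltonian_numerator_def Let_def of_complex_const_arith vars[symmetric]
    by simp algebra
  then have "x dvd N - B" by (auto simp: dvd_def)
  moreover have "partial_y B = 0" "partial_y x = 0"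
    by (simp_all add: B_def vars partial_simps)
  ultimately have "x dvd partial_y N"
    using derivation_dvd_diff[OF derivation_partial(2), of x N B] by simp
  then show ?thesis
    by (intro invariant_divisor_hamiltonianI[OF N_def]) (simp add: partial_simps x_def)
qed

text \<open>
  The polynomial \<open>B\<close> below is the restriction of \<open>N\<close> to \<open>z = - x\<close>. The relation
  \<open>\<alpha>\<^sub>0 = 1 - 2 \<alpha>\<^sub>1\<close> makes its terms linear in \<open>y\<close> and in \<open>w\<close> combine to multiples of \<open>y - w\<close>.
\<close>

lemma invariant_divisor_x_plus_z:
  "invariant_divisor (hamiltonian (1 - 2 * a1) a1 0) (var_x + var_z)"
proof -
  define N where "N = hamiltonian_numerator (1 - 2 * a1) a1 0"
  define t x y z w \<alpha>1
    where "t = var_t" and "x = var_x" and "y = var_y" and "z = var_z" and "w = var_w"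
      and "\<alpha>1 = of_complex_const a1"
  note vars = t_def x_def y_def z_def w_def \<alpha>1_def
  define p where "p = y - w"
  define B where "B = (12*p^3 - 12*t*(t - p^2)^2 - 108*t*p + 81) * x^2
      + (8*(6*\<alpha>1 - 7)*t^2*p + 24*(1 - 2*\<alpha>1)*t*p^3 + 9*(17 - 12*\<alpha>1)*t + 3*(12*\<alpha>1 + 1)*p^2) * x
      - 12*(1 - 2*\<alpha>1)^2*t*p^2 + 3*(8*\<alpha>1^2 + 6*\<alpha>1 - 5)*p"
  define d where "d g = partial_y g + partial_w g" for g
  have d: "derivation d"
    by (simp add: derivation_def d_def partial_simps algebra_simps)
  have "\<exists>k. N - B = (x + z) * k"
    unfolding N_def B_def p_def hamiltonian_numerator_def Let_def of_complex_const_arith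
      vars[symmetric]
    by simp algebra
  then have "x + z dvd N - B" by (auto simp: dvd_def)
  moreover have "d p = 0" "d t = 0" "d x = 0" "d \<alpha>1 = 0" "d z = 0"
    by (simp_all add: p_def d_def vars partial_simps)
  then have "d B = 0" "d (x + z) = 0"
    by (simp_all add: B_def derivation_rules[OF d])
  ultimately have "x + z dvd d N"
    using derivation_dvd_diff[OF d, of "x + z" N B] by simp
  then show ?thesis
    by (intro invariant_divisor_hamiltonianI[OF N_def])
      (simp add: partial_simps d_def x_def z_def)
qed

text \<open>
  On the hypersurface \<open>f = 0\<close> the coordinates \<open>y\<close> and \<open>w\<close> determine \<open>t = w\<^sup>2 + 1/y\<close>, and
  \<open>x\<close> and \<open>z\<close> are free. Replacing \<open>z\<close> by \<open>v\<close> straightens the field \<open>d\<close> to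
  \<open>y\<^sup>-\<^sup>1 \<partial>\<^sub>x\<close>, and in these coordinates \<open>x\<close> enters \<open>N\<close> only through the term \<open>\<Delta> y\<^sup>2 x\<close>.
\<close>

lemma invariant_divisor_y_w2_minus_t_y_plus_1:
  "invariant_divisor (hamiltonian a0 0 (1 - a0)) (var_y * var_w^2 - var_t * var_y + 1)"
proof -
  define N where "N = hamiltonian_numerator a0 0 (1 - a0)"
  define t x y z w \<alpha>0
    where "t = var_t" and "x = var_x" and "y = var_y" and "z = var_z" and "w = var_w"
      and "\<alpha>0 = of_complex_const a0"
  note vars = t_def x_def y_def z_def w_def \<alpha>0_def
  define f where "f = y*w^2 - t*y + 1"
  define \<Delta> where "\<Delta> = hamiltonian_denominator"
  have \<Delta>: "\<Delta> = (4*t + 3)*(16*t^2 - 12*t + 9)"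
    by (simp add: \<Delta>_def hamiltonian_denominator_def t_def)
  define v where "v = z + 2*y^2*w*x"
  define b2 where "b2 = 12*w*(t - w^2) - 12*t*(t - w^2)^2 - 3"
  define b1 where "b1 = 12*\<alpha>0*y*w - 8*t*w*(7*t - 3*w^2) - 3*(4*\<alpha>0 + 7)*t + 3*(3 - 4*\<alpha>0)*w^2"
  define b0 where "b0 = 24*\<alpha>0*y*w^3 - 12*t*w^2 - 12*\<alpha>0^2*y^2*w^2 - 27*\<alpha>0*y + 36*\<alpha>0*w + 3*w"
  define B where "B = \<Delta>*y^2*x + b2*v^2 + b1*v + b0"
  define d where "d g = (t - w^2) * partial_x g - 2*y*w * partial_z g" for g
  have d: "derivation d"
    by (simp add: derivation_def d_def partial_simps algebra_simps)
  have const: "d t = 0" "d y = 0" "d w = 0" "d \<alpha>0 = 0"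
    and dx: "d x = t - w^2" and dz: "d z = - 2*y*w"
    by (simp_all add: d_def vars partial_simps)
  note d_simps = const derivation_rules[OF d]
  have df: "d f = 0" and coeffs: "d \<Delta> = 0" "d b0 = 0" "d b1 = 0" "d b2 = 0"
    by (simp_all add: f_def \<Delta> b0_def b1_def b2_def d_simps)
  have dv: "d v = - 2*y*w * f"
    by (simp add: v_def d_simps dx dz f_def algebra_simps power2_eq_square)
  have dB: "d B = \<Delta>*y^2*(t - w^2) - 2*y*w*(2*b2*v + b1) * f"
    by (simp add: B_def d_simps dx dv coeffs algebra_simps)
  have "\<exists>k. N - B = f * k"
    unfolding N_def B_def b0_def b1_def b2_def v_def f_def \<Delta> hamiltonian_numerator_def Let_def
      of_complex_const_arith vars[symmetric]
    by simp algebra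
  then have "f dvd d N - d B"
    by (intro derivation_dvd_diff[OF d df]) (auto simp: dvd_def)
  \<comment> \<open>The factor \<open>y (t - w\<^sup>2)\<close> of the first term of \<open>d B\<close> equals \<open>1 - f\<close>.\<close>
  moreover have "d B - \<Delta>*y = f * (- \<Delta>*y - 2*y*w*(2*b2*v + b1))"
    unfolding dB f_def by algebra
  ultimately have "f dvd (d N - d B) + (d B - \<Delta>*y)"
    by (metis dvd_add dvd_triv_left)
  then have "f dvd d N - \<Delta>*y" by simp
  then have "invariant_divisor (hamiltonian a0 0 (1 - a0)) f"
    by (intro invariant_divisor_hamiltonianI[OF N_def])
      (simp add: f_def d_def \<Delta>_def vars partial_simps algebra_simps)
  then show ?thesis
    by (simp add: f_def vars)
qed

theorem proposition5p2:
  fixes \<alpha>0 \<alpha>1 \<alpha>2 :: complex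
  assumes "\<alpha>0 + 2 * \<alpha>1 + \<alpha>2 = 1"
  shows "(\<alpha>0 = 0 \<longrightarrow>
            invariant_divisor (hamiltonian \<alpha>0 \<alpha>1 \<alpha>2) var_x)
       \<and> (\<alpha>1 = 0 \<longrightarrow>
            invariant_divisor (hamiltonian \<alpha>0 \<alpha>1 \<alpha>2)
              (var_y * var_w^2 - var_t * var_y + 1))
       \<and> (\<alpha>2 = 0 \<longrightarrow>
            invariant_divisor (hamiltonian \<alpha>0 \<alpha>1 \<alpha>2) (var_x + var_z))"
proof (intro conjI impI)
  assume "\<alpha>0 = 0"
  then show "invariant_divisor (hamiltonian \<alpha>0 \<alpha>1 \<alpha>2) var_x"
    using invariant_divisor_x by simp
next
  assume "\<alpha>1 = 0"
  moreover from this assms have "\<alpha>2 = 1 - \<alpha>0" by (simp add: algebra_simps)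
  ultimately show "invariant_divisor (hamiltonian \<alpha>0 \<alpha>1 \<alpha>2)
      (var_y * var_w^2 - var_t * var_y + 1)"
    using invariant_divisor_y_w2_minus_t_y_plus_1 by simp
next
  assume "\<alpha>2 = 0"
  moreover from this assms have "\<alpha>0 = 1 - 2 * \<alpha>1" by (simp add: algebra_simps)
  ultimately show "invariant_divisor (hamiltonian \<alpha>0 \<alpha>1 \<alpha>2) (var_x + var_z)"
    using invariant_divisor_x_plus_z by simp
qed

end
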